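(* Let $E_1|H_1,\ldots,E_n|H_n$ be $n$ conditional events with $E_1,H_1,\ldots,E_n,H_n$ logically independent. Let $\mathcal{M}=(x_S:\emptyset\neq S\subseteq\{1,\ldots,n\})$ be a coherent prevision assessment on the family $\mathscr{F}=\{\mathscr{C}_S:\emptyset\neq S\subseteq\{1,\ldots,n\}\}$, where $\mathscr{C}_S=\bigwedge_{i\in S}(E_i|H_i)$ and $x_S=\mathbb{P}(\mathscr{C}_S)$. Let $C_0,\ldots,C_{3^n-1}$ be the constituents obtained by expanding $\bigwedge_{i=1}^n(E_iH_i\vee\overline{E}_iH_i\vee\overline{H}_i)$ and, for each $h$, let $Q_h=(q_{hS}:\emptyset\neq S\subseteq\{1,\ldots,n\})$, where $q_{hS}$ is the value of $\mathscr{C}_S$ when $C_h$ is true. Then every point $Q_h$ is a coherent prevision assessment on $\mathscr{F}$, or equivalently $Q_h\in\mathcal{I}_{\mathcal{B}}$, where $\mathcal{I}_{\mathcal{B}}$ is the convex hull of the set $\mathcal{B}$ of the $2^n$ binary points.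
   Context: Events. Events are elements of a Boolean algebra with top $\Omega$ (sure event) and bottom $\emptyset$ (impossible event); one may take subsets of a set $\Omega$. An event is identified with its $0/1$ indicator; $EF$ or $E\wedge F$ is conjunction, $E\vee F$ disjunction, $\overline{E}$ negation. Events $A_1,\ldots,A_m$ are logically independent if all $2^m$ conjunctions $A_1^*\cdots A_m^*$ with $A_i^*\in\{A_i,\overline{A}_i\}$ are $\neq\emptyset$. Conditional random quantities. Given an event $H\neq\emptyset$, a random quantity $X$ (a real-valued function on $\Omega$ with finitely many values on $H$) and an assessed real number $\mu=\mathbb{P}(X|H)$ (the conditional prevision), the conditional random quantity $X|H$ is $XH+\mu\overline{H}$ (value $X$ if $H$ is true, $\mu$ if $H$ is false). For a conditional event $E|H$ with $P(E|H)=x$, its indicator (same symbol) is $E|H=EH+x\overline{H}$; it is true, false or void when $EH$, $\overline{E}H$ or $\overline{H}$ is true, respectively. Coherence. A prevision assessment on a family of conditional random quantities is coherent if for every finite subfamily $X_1|H_1,\ldots,X_m|H_m$ with assessed previsions $\mu_1,\ldots,\mu_m$ and all real $s_1,\ldots,s_m$, the random gain $G=\sum_{i=1}^m s_iH_i(X_i-\mu_i)$, restricted to $H_1\vee\cdots\vee H_m$, satisfies $\min G\le 0\le\max G$. Conjunction. For a finite family $(E_i|H_i)_{i\in T}$ of conditional events, the conjunctions $\mathscr{C}_S=\bigwedge_{i\in S}(E_i|H_i)$, $\emptyset\ne S\subseteq T$, with assessed previsions $x_S=\mathbb{P}(\mathscr{C}_S)$, are defined recursively on $|S|$ by \[ \mathscr{C}_S=\Big[\bigwedge_{i\in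 S}E_iH_i+\sum_{\emptyset\neq R\subsetneq S}x_R\Big(\bigwedge_{i\in R}\overline{H}_i\Big)\wedge\Big(\bigwedge_{i\in S\setminus R}E_iH_i\Big)\Big]\Big|\Big(\bigvee_{i\in S}H_i\Big), \] i.e. $\mathscr{C}_S$ has value $1$ if all $E_iH_i$ ($i\in S$) are true; $0$ if some $\overline{E}_iH_i$ is true; $x_R$ if exactly the conditional events with index in $R$ are void and the others are true ($\emptyset\ne R\subsetneq S$); $x_S$ if all $H_i$, $i\in S$, are false. For $S=\{i\}$, $\mathscr{C}_S=E_i|H_i$. The conjunctions depend on the assessment: saying that a vector $(z_S)_S$ is a coherent assessment on $\mathscr{F}$ means that it is coherent for the conjunctions $\mathscr{C}_S$ constructed with $z_R$ in place of $x_R$. Binary points. $\mathcal{B}$ is the set of the $2^n$ points $Q_h$ associated with the constituents $C_h\subseteq H_1\cdots H_n$ (those obtained by expanding $\bigwedge_{i=1}^n(E_iH_i\vee\overline{E}_iH_i)$). Explicitly $\mathcal{B}=\{Q_A:A\subseteq\{1,\ldots,n\}\}$, where $Q_A=(q_{A,S})_S$ with $q_{A,S}=1$ if $S\subseteq A$ and $0$ otherwise. *)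

theory Defs
  imports "HOL-Analysis.Analysis"
begin

text \<open>
  Events are subsets of the sample space \<^term>\<open>UNIV :: 'w set\<close>.  A finite type \<^typ>\<open>'n::finite\<close>
  indexes the conditional events, so the number of conditional events is \<^term>\<open>CARD('n::finite)\<close>.
\<close>

definition logically_independent :: "('k \<Rightarrow> 'w set) \<Rightarrow> bool" where
  "logically_independent A \<longleftrightarrow> (\<forall>J. (\<Inter>i\<in>J. A i) \<inter> (\<Inter>i\<in>- J. - A i) \<noteq> {})"

definition cond_quantity :: "('w \<Rightarrow> real) \<Rightarrow> 'w set \<Rightarrow> real \<Rightarrow> 'w \<Rightarrow> real" where
  "cond_quantity X H \<mu> \<omega> = X \<omega> * indicator H \<omega> + \<mu> * indicator (- H) \<omega>"

definition random_gain ::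
    "('k \<Rightarrow> 'w \<Rightarrow> real) \<Rightarrow> ('k \<Rightarrow> 'w set) \<Rightarrow> ('k \<Rightarrow> real) \<Rightarrow> ('k \<Rightarrow> real) \<Rightarrow> 'k set \<Rightarrow> 'w \<Rightarrow> real" where
  "random_gain X H \<mu> s J \<omega> = (\<Sum>k\<in>J. s k * indicator (H k) \<omega> * (X k \<omega> - \<mu> k))"

text \<open>
  Coherence of the assessment \<open>\<mu> k\<close> on the family \<open>X k | H k\<close>.  As usual, it is meant for
  conditioning events \<open>H k \<noteq> {}\<close> and quantities \<open>X k\<close> with finitely many values on \<open>H k\<close>; then
  the sets below are finite and nonempty, so \<^const>\<open>Min\<close> and \<^const>\<open>Max\<close> are meaningful.
\<close>

definition coherent ::
    "('k \<Rightarrow> 'w \<Rightarrow> real) \<Rightarrow> ('k \<Rightarrow> 'w set) \<Rightarrow> ('k \<Rightarrow> real) \<Rightarrow> bool" where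
  "coherent X H \<mu> \<longleftrightarrow>
     (\<forall>J s. finite J \<and> J \<noteq> {} \<longrightarrow>
        Min (random_gain X H \<mu> s J ` (\<Union>k\<in>J. H k)) \<le> 0 \<and>
        0 \<le> Max (random_gain X H \<mu> s J ` (\<Union>k\<in>J. H k)))"

text \<open>
  The coordinates of an assessment are indexed by the nonempty sets of indices.  Making these a
  finite type turns assessments into elements of a Euclidean space.
\<close>

typedef 'n neset = "{S :: 'n set. S \<noteq> {}}"
  morphisms elems neset
  by blast

instance neset :: (finite) finite
proof
  have "inj (elems :: 'a neset \<Rightarrow> 'a set)"
    by (simp add: inj_on_def elems_inject)
  then show "finite (UNIV :: 'a neset set)"
    by (rule finite_imageD[rotated]) simp
qed

definition prevision :: "real ^ 'n::finite neset \<Rightarrow> 'n set \<Rightarrow> real" where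
  "prevision x S = x $ neset S"

lemma elems_nonempty [simp]: "elems S \<noteq> {}"
  using elems[of S] by simp

lemma prevision_elems [simp]: "prevision x (elems S) = x $ S"
  by (simp add: prevision_def elems_inverse)

definition conj_event :: "('n \<Rightarrow> 'w set) \<Rightarrow> ('n \<Rightarrow> 'w set) \<Rightarrow> 'n set \<Rightarrow> 'w set" where
  "conj_event E H S = (\<Inter>i\<in>S. E i \<inter> H i)"

definition void_event :: "('n \<Rightarrow> 'w set) \<Rightarrow> 'n set \<Rightarrow> 'w set" where
  "void_event H S = (\<Inter>i\<in>S. - H i)"

text \<open>
  The conjunction of the \<open>E i | H i\<close>, \<open>i \<in> S\<close>, is \<open>conj_quantity E H x S | conj_cond H S\<close>, where the
  previsions of the smaller conjunctions, and of the conjunction itself, are read off from \<open>x\<close>.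
\<close>

definition conj_quantity ::
    "('n::finite \<Rightarrow> 'w set) \<Rightarrow> ('n \<Rightarrow> 'w set) \<Rightarrow> real ^ 'n neset \<Rightarrow> 'n set \<Rightarrow> 'w \<Rightarrow> real" where
  "conj_quantity E H x S \<omega> =
     indicator (conj_event E H S) \<omega> +
     (\<Sum>R | R \<noteq> {} \<and> R \<subset> S.
        prevision x R * indicator (void_event H R \<inter> conj_event E H (S - R)) \<omega>)"

definition conj_cond :: "('n \<Rightarrow> 'w set) \<Rightarrow> 'n set \<Rightarrow> 'w set" where
  "conj_cond H S = (\<Union>i\<in>S. H i)"

definition conjunction ::
    "('n::finite \<Rightarrow> 'w set) \<Rightarrow> ('n \<Rightarrow> 'w set) \<Rightarrow> real ^ 'n neset \<Rightarrow> 'n set \<Rightarrow> 'w \<Rightarrow> real" where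
  "conjunction E H x S = cond_quantity (conj_quantity E H x S) (conj_cond H S) (prevision x S)"

definition coherent_conjunctions ::
    "('n::finite \<Rightarrow> 'w set) \<Rightarrow> ('n \<Rightarrow> 'w set) \<Rightarrow> real ^ 'n neset \<Rightarrow> bool" where
  "coherent_conjunctions E H x \<longleftrightarrow>
     coherent (\<lambda>S. conj_quantity E H x (elems S)) (\<lambda>S. conj_cond H (elems S)) (\<lambda>S. x $ S)"

definition constituents :: "('n \<Rightarrow> 'w set) \<Rightarrow> ('n \<Rightarrow> 'w set) \<Rightarrow> 'w set set" where
  "constituents E H =
     {\<Inter>i. c i | c. \<forall>i. c i \<in> {E i \<inter> H i, - E i \<inter> H i, - H i}} - {{}}"

text \<open>
  Each conjunction is constant on each constituent (see \<open>constituent_point_eq\<close> below), so the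
  description operator picks its value there.
\<close>

definition constituent_point ::
    "('n::finite \<Rightarrow> 'w set) \<Rightarrow> ('n \<Rightarrow> 'w set) \<Rightarrow> real ^ 'n neset \<Rightarrow> 'w set \<Rightarrow> real ^ 'n neset" where
  "constituent_point E H x C =
     (\<chi> S. THE v. conjunction E H x (elems S) ` C = {v})"

definition binary_points ::
    "('n::finite \<Rightarrow> 'w set) \<Rightarrow> ('n \<Rightarrow> 'w set) \<Rightarrow> real ^ 'n neset \<Rightarrow> (real ^ 'n neset) set" where
  "binary_points E H x =
     constituent_point E H x ` {C \<in> constituents E H. C \<subseteq> (\<Inter>i. H i)}"

lemma conjunction_value:
  assumes "S \<noteq> {}"
  shows "conjunction E H x S \<omega> =
    (if \<exists>i\<in>S. \<omega> \<in> - E i \<inter> H i then 0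
     else if {i \<in> S. \<omega> \<notin> H i} = {} then 1
     else prevision x {i \<in> S. \<omega> \<notin> H i})"
proof -
  define V where "V = {i \<in> S. \<omega> \<notin> H i}"
  define P where "P \<longleftrightarrow> (\<exists>i\<in>S. \<omega> \<in> - E i \<inter> H i)"
  have V: "V \<subseteq> S"
    by (auto simp: V_def)
  have "conjunction E H x S \<omega> = (if P then 0 else if V = {} then 1 else prevision x V)"
  proof (cases "V = S")
    case True
    then have "\<omega> \<notin> conj_cond H S" "\<not> P"
      by (auto simp: conj_cond_def V_def P_def)
    then show ?thesis
      using True assms by (simp add: conjunction_def cond_quantity_def)
  next
    case False
    then have cond: "\<omega> \<in> conj_cond H S"
      by (auto simp: conj_cond_def V_def)
    have "\<omega> \<in> void_event H R \<inter> conj_event E H (S - R) \<longleftrightarrow> R = V \<and> \<not> P" if "R \<subset> S" for R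
      using that unfolding void_event_def conj_event_def V_def P_def by blast
    then have ind: "indicator (void_event H R \<inter> conj_event E H (S - R)) \<omega> =
                 (if R = V \<and> \<not> P then 1 else (0::real))" if "R \<subset> S" for R
      using that by (simp only: indicator_def of_bool_def)
    have "\<omega> \<in> conj_event E H S \<longleftrightarrow> V = {} \<and> \<not> P"
      unfolding conj_event_def V_def P_def by blast
    then have ind0: "indicator (conj_event E H S) \<omega> = (if V = {} \<and> \<not> P then 1 else (0::real))"
      by (simp add: indicator_def)
    have "(\<Sum>R | R \<noteq> {} \<and> R \<subset> S.
             prevision x R * indicator (void_event H R \<inter> conj_event E H (S - R)) \<omega>) =
          (\<Sum>R | R \<noteq> {} \<and> R \<subset> S. if R = V then (if P then 0 else prevision x R) else 0)"
      by (rule sum.cong) (simp_all add: ind)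
    also have "\<dots> = (if V \<noteq> {} then (if P then 0 else prevision x V) else 0)"
      using False V by (simp add: sum.delta psubset_eq)
    finally have "conj_quantity E H x S \<omega> =
        (if V = {} \<and> \<not> P then 1 else 0) +
        (if V \<noteq> {} then (if P then 0 else prevision x V) else 0)"
      unfolding conj_quantity_def ind0 by simp
    with cond show ?thesis
      by (simp add: conjunction_def cond_quantity_def)
  qed
  then show ?thesis
    by (simp only: V_def P_def)
qed

lemma constituent_same_value:
  assumes "C \<in> constituents E H" "\<omega> \<in> C" "\<omega>' \<in> C" "S \<noteq> {}"
  shows "conjunction E H x S \<omega> = conjunction E H x S \<omega>'"
proof -
  from assms(1) obtain c where c: "C = (\<Inter>i. c i)"
    "\<And>i. c i \<in> {E i \<inter> H i, - E i \<inter> H i, - H i}"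
    unfolding constituents_def by blast
  have eq: "(\<omega> \<in> H i \<longleftrightarrow> \<omega>' \<in> H i) \<and>
            (\<omega> \<in> - E i \<inter> H i \<longleftrightarrow> \<omega>' \<in> - E i \<inter> H i)" for i
    using c(2)[of i] assms(2,3) unfolding c(1) by blast
  have "(\<exists>i\<in>S. \<omega> \<in> - E i \<inter> H i) \<longleftrightarrow> (\<exists>i\<in>S. \<omega>' \<in> - E i \<inter> H i)"
    using eq by blast
  moreover have "{i \<in> S. \<omega> \<notin> H i} = {i \<in> S. \<omega>' \<notin> H i}"
    using eq by blast
  ultimately show ?thesis
    unfolding conjunction_value[OF assms(4)] by (simp only:)
qed

lemma constituent_point_eq:
  assumes "C \<in> constituents E H" "\<omega> \<in> C"
  shows "constituent_point E H x C $ S = conjunction E H x (elems S) \<omega>"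
proof -
  have "conjunction E H x (elems S) ` C = {conjunction E H x (elems S) \<omega>}"
    using constituent_same_value[OF assms(1) _ assms(2) elems_nonempty]
      image_constant[OF assms(2), of "conjunction E H x (elems S) \<omega>"]
    by (simp cong: image_cong_simp)
  then show ?thesis
    by (simp add: constituent_point_def)
qed

lemma binary_points_eq:
  assumes "logically_independent (case_sum E H)"
  shows "binary_points E H x = range (\<lambda>A. \<chi> S. if elems S \<subseteq> A then 1 else 0)"
    (is "_ = range ?Q")
proof
  have point: "constituent_point E H x C = ?Q A"
    if C: "C \<in> constituents E H" "\<omega> \<in> C" "\<And>i. \<omega> \<in> H i" "A = {i. \<omega> \<in> E i}" for C A \<omega>
    by (simp add: vec_eq_iff constituent_point_eq[OF C(1,2)] conjunction_value C(3,4) subset_iff)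
  show "binary_points E H x \<subseteq> range ?Q"
  proof
    fix q assume "q \<in> binary_points E H x"
    then obtain C where C: "C \<in> constituents E H" "C \<subseteq> (\<Inter>i. H i)" "q = constituent_point E H x C"
      unfolding binary_points_def by blast
    from C(1) obtain \<omega> where "\<omega> \<in> C"
      unfolding constituents_def by blast
    with C(2) have "\<omega> \<in> H i" for i
      by blast
    with C(1,3) \<open>\<omega> \<in> C\<close> have "q = ?Q {i. \<omega> \<in> E i}"
      by (simp only: point)
    then show "q \<in> range ?Q"
      by (rule range_eqI)
  qed
  show "range ?Q \<subseteq> binary_points E H x"
  proof
    fix q assume "q \<in> range ?Q"
    then obtain A where q: "q = ?Q A"
      by blast
    let ?J = "Inl ` A \<union> range Inr"
    have "(\<Inter>k\<in>?J. case_sum E H k) \<inter> (\<Inter>k\<in>- ?J. - case_sum E H k) \<noteq> {}"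
      using assms unfolding logically_independent_def by (rule spec)
    then obtain \<omega> where
      "\<omega> \<in> (\<Inter>k\<in>?J. case_sum E H k) \<inter> (\<Inter>k\<in>- ?J. - case_sum E H k)"
      by (meson ex_in_conv)
    then have \<omega>: "\<omega> \<in> (\<Inter>k\<in>?J. case_sum E H k)" "\<omega> \<in> (\<Inter>k\<in>- ?J. - case_sum E H k)"
      by (simp_all only: Int_iff)
    have H: "\<omega> \<in> H i" for i
      using INT_D[OF \<omega>(1), of "Inr i"] by simp
    have E: "\<omega> \<in> E i \<longleftrightarrow> i \<in> A" for i
    proof
      assume "\<omega> \<in> E i"
      show "i \<in> A"
      proof (rule ccontr)
        assume "i \<notin> A"
        then have "Inl i \<in> - ?J"
          by auto
        with \<omega>(2) have "\<omega> \<in> - case_sum E H (Inl i)"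
          by blast
        with \<open>\<omega> \<in> E i\<close> show False
          by simp
      qed
    qed (use INT_D[OF \<omega>(1), of "Inl i"] in simp)
    define c where "c i = (if i \<in> A then E i \<inter> H i else - E i \<inter> H i)" for i
    have \<omega>c: "\<omega> \<in> (\<Inter>i. c i)"
      using H E by (auto simp: c_def)
    have "\<forall>i. c i \<in> {E i \<inter> H i, - E i \<inter> H i, - H i}"
      by (simp add: c_def)
    with \<omega>c have C: "(\<Inter>i. c i) \<in> constituents E H"
      unfolding constituents_def by blast
    have "c i \<subseteq> H i" for i
      by (simp add: c_def)
    then have "(\<Inter>i. c i) \<subseteq> (\<Inter>i. H i)"
      by blast
    with C have "(\<Inter>i. c i) \<in> {C \<in> constituents E H. C \<subseteq> (\<Inter>i. H i)}"
      by (simp only: mem_Collect_eq)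
    moreover have "q = constituent_point E H x (\<Inter>i. c i)"
      unfolding q by (rule point[OF C \<omega>c H, symmetric]) (simp add: E)
    ultimately show "q \<in> binary_points E H x"
      unfolding binary_points_def by (rule rev_image_eqI)
  qed
qed

end

theory Submission
  imports Defs
begin

text \<open>
  For a fixed assessment \<open>z\<close>, the vector of values of all conjunctions depends only on the set
  \<open>D\<close> of true and the set \<open>R\<close> of void conditional events.  As a function of \<open>z\<close> it is affine, it
  reads only the coordinates inside \<open>R\<close>, and, \<open>D\<close> and \<open>R\<close> being disjoint, it sends the binary
  point of \<open>B \<subseteq> R\<close> to the binary point of \<open>D \<union> B\<close>.  So if \<open>z\<close> restricted to \<open>R\<close>
  is a mixture of binary points, then so is the whole vector of values (\<open>status_point_in_hull\<close>).

  This one observation is used twice.  In \<open>coherent_imp_restriction_in_hull\<close> it gives, by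
  induction on a set \<open>T\<close> of indices, that a coherent \<open>z\<close> restricted to \<open>T\<close> is a mixture of binary
  points of \<open>T\<close>: outside the case in which all of \<open>T\<close> is void, only a proper subset of \<open>T\<close> is
  void, so by induction every possible vector of values on \<open>T\<close> lies in the hull; were the
  restriction of \<open>z\<close> outside, the coefficients of a separating hyperplane would be stakes with a uniformly
  positive gain.  Applied once more, to the given coherent assessment and the void set of an
  arbitrary constituent, the observation places the constituent point in the hull of the
  binary points.

  Conversely, every point of that hull is coherent (\<open>hull_imp_coherent\<close>): the gain is affine in
  the vector of values and vanishes at \<open>z\<close>, so it cannot have a constant strict sign on the
  binary points, all of which are possible vectors of values by logical independence.
\<close>

section \<open>The vector of values of the conjunctions\<close>

definition binary_point :: "'n set \<Rightarrow> real ^ 'n::finite neset" where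
  "binary_point A = (\<chi> S. if elems S \<subseteq> A then 1 else 0)"

text \<open>
  The values of all conjunctions when the conditional events in \<open>D\<close> are true, those in \<open>R\<close> are
  void and the others are false.  With \<open>D = {}\<close> this is the assessment \<open>z\<close> itself, cut down to
  the coordinates inside \<open>R\<close> and zero elsewhere; restrictions of assessments to a subfamily are
  written in this way, so that they remain in one Euclidean space.
\<close>

definition status_point ::
    "'n set \<Rightarrow> 'n set \<Rightarrow> real ^ 'n neset \<Rightarrow> real ^ 'n::finite neset" where
  "status_point D R z =
     (\<chi> S. if elems S \<subseteq> D \<union> R
           then if elems S \<inter> R = {} then 1 else prevision z (elems S \<inter> R)
           else 0)"

definition true_indices :: "('n \<Rightarrow> 'w set) \<Rightarrow> ('n \<Rightarrow> 'w set) \<Rightarrow> 'w \<Rightarrow> 'n set" where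
  "true_indices E H \<omega> = {i. \<omega> \<in> E i \<inter> H i}"

definition void_indices :: "('n \<Rightarrow> 'w set) \<Rightarrow> 'w \<Rightarrow> 'n set" where
  "void_indices H \<omega> = {i. \<omega> \<notin> H i}"

lemma elems_neset: "S \<noteq> {} \<Longrightarrow> elems (neset S) = S"
  by (simp add: neset_inverse)

lemma conjunction_eq_status_point:
  "conjunction E H z (elems S) \<omega> =
     status_point (true_indices E H \<omega>) (void_indices H \<omega>) z $ S"
proof -
  have "(\<exists>i\<in>elems S. \<omega> \<in> - E i \<inter> H i) \<longleftrightarrow>
        \<not> elems S \<subseteq> true_indices E H \<omega> \<union> void_indices H \<omega>"
    by (auto simp: true_indices_def void_indices_def)
  moreover have "{i \<in> elems S. \<omega> \<notin> H i} = elems S \<inter> void_indices H \<omega>"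
    by (auto simp: void_indices_def)
  ultimately show ?thesis
    by (simp only: conjunction_value[OF elems_nonempty] status_point_def vec_lambda_beta if_not_P
        not_not split: if_split) simp
qed

lemma constituent_point_eq_status_point:
  assumes "C \<in> constituents E H" "\<omega> \<in> C"
  shows "constituent_point E H z C =
           status_point (true_indices E H \<omega>) (void_indices H \<omega>) z"
  by (simp add: vec_eq_iff constituent_point_eq[OF assms] conjunction_eq_status_point)

lemma status_point_no_void: "status_point D {} z = binary_point D"
  by (simp add: status_point_def binary_point_def vec_eq_iff)

text \<open>
  Putting the binary point of \<open>A\<close> in place of the previsions amounts to deciding the void
  conditional events: those in \<open>A\<close> become true, the others false.  An index in both \<open>D\<close> and \<open>R\<close>
  counts as void, whence \<open>D - R\<close>.
\<close>

lemma status_point_binary: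
  assumes "A \<subseteq> R"
  shows "status_point D R (binary_point A) = binary_point (D - R \<union> A)"
proof -
  have "prevision (binary_point A) (elems S \<inter> R) = (if elems S \<inter> R \<subseteq> A then 1 else 0)"
    if "elems S \<inter> R \<noteq> {}" for S :: "'a neset"
    using that by (simp add: prevision_def binary_point_def elems_neset)
  moreover have "elems S \<subseteq> D - R \<union> A \<longleftrightarrow> elems S \<subseteq> D \<union> R \<and> elems S \<inter> R \<subseteq> A" for S :: "'a neset"
    using assms by blast
  ultimately show ?thesis
    by (auto simp: status_point_def binary_point_def vec_eq_iff)
qed

lemma status_point_restriction:
  "status_point D R (status_point {} R z) = status_point D R z"
  by (simp add: status_point_def vec_eq_iff prevision_def elems_neset inf_assoc)

lemma status_point_affine:
  assumes "u + v = (1::real)"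
  shows "status_point D R (u *\<^sub>R y + v *\<^sub>R z) = u *\<^sub>R status_point D R y + v *\<^sub>R status_point D R z"
  using assms by (simp add: status_point_def vec_eq_iff prevision_def)

text \<open>
  An affine map sends mixtures to mixtures, and \<open>status_point D R\<close> sends the binary points of
  \<open>R\<close> to binary points of \<open>D \<union> R\<close>.
\<close>

lemma status_point_in_hull:
  assumes "status_point {} R z \<in> convex hull (binary_point ` Pow R)"
  shows "status_point D R z \<in> convex hull (binary_point ` Pow (D \<union> R))"
proof -
  let ?K = "convex hull (binary_point ` Pow (D \<union> R))"
  have "binary_point ` Pow R \<subseteq> {y. status_point D R y \<in> ?K}"
    by (auto simp: status_point_binary intro!: hull_inc)
  moreover have "convex {y. status_point D R y \<in> ?K}"
    using convex_convex_hull[of "binary_point ` Pow (D \<union> R)"]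
    unfolding convex_def by (simp add: status_point_affine)
  ultimately have "convex hull (binary_point ` Pow R) \<subseteq> {y. status_point D R y \<in> ?K}"
    by (rule hull_minimal)
  with assms show ?thesis
    by (auto simp: status_point_restriction)
qed

section \<open>Coherence in terms of gains\<close>

text \<open>
  When the conditioning event of \<open>S\<close> fails, the conjunction takes the value \<open>z $ S\<close> and its
  difference to the prevision vanishes, so the gain can be written without indicators.
\<close>

lemma random_gain_eq:
  "random_gain (\<lambda>S. conj_quantity E H z (elems S)) (\<lambda>S. conj_cond H (elems S)) (\<lambda>S. z $ S) s J \<omega> =
     (\<Sum>S\<in>J. s S * (status_point (true_indices E H \<omega>) (void_indices H \<omega>) z $ S - z $ S))"
  unfolding random_gain_def
  by (rule sum.cong)
    (auto simp: conjunction_eq_status_point[symmetric] conjunction_def cond_quantity_def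
      indicator_def)

lemma finite_random_gains:
  fixes E H :: "'n::finite \<Rightarrow> 'w set"
  shows "finite (random_gain (\<lambda>S. conj_quantity E H z (elems S)) (\<lambda>S. conj_cond H (elems S))
           (\<lambda>S. z $ S) s J ` W)"
proof -
  let ?g = "\<lambda>(D, R). \<Sum>S\<in>J. s S * (status_point D R z $ S - z $ S)"
  have "random_gain (\<lambda>S. conj_quantity E H z (elems S)) (\<lambda>S. conj_cond H (elems S))
          (\<lambda>S. z $ S) s J ` W \<subseteq> range ?g"
  proof
    fix t assume "t \<in> random_gain (\<lambda>S. conj_quantity E H z (elems S))
        (\<lambda>S. conj_cond H (elems S)) (\<lambda>S. z $ S) s J ` W"
    then obtain \<omega> where "t = ?g (true_indices E H \<omega>, void_indices H \<omega>)"
      unfolding random_gain_eq prod.case by blast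
    then show "t \<in> range ?g"
      by (rule range_eqI)
  qed
  then show ?thesis
    by (rule finite_subset) simp
qed

section \<open>Coherent assessments are mixtures of binary points\<close>

lemma coherent_imp_restriction_in_hull:
  fixes E H :: "'n::finite \<Rightarrow> 'w set"
  assumes nonempty: "\<And>i. H i \<noteq> {}"
    and coh: "coherent_conjunctions E H z"
  shows "status_point {} T z \<in> convex hull (binary_point ` Pow T)"
proof (induction "card T" arbitrary: T rule: less_induct)
  case less
  let ?K = "convex hull (binary_point ` Pow T) :: (real ^ 'n neset) set"
  let ?D = "true_indices E H" and ?R = "void_indices H"
  show ?case
  proof (cases "T = {}")
    case True
    then show ?thesis
      by (simp add: status_point_no_void)
  next
    case False
    have values_in_hull: "status_point (?D \<omega> \<inter> T) (?R \<omega> \<inter> T) z \<in> ?K"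
      if "i \<in> T" "\<omega> \<in> H i" for i \<omega>
    proof -
      have "?R \<omega> \<inter> T \<subset> T"
        using that by (auto simp: void_indices_def)
      then have "status_point {} (?R \<omega> \<inter> T) z \<in> convex hull (binary_point ` Pow (?R \<omega> \<inter> T))"
        by (intro less psubset_card_mono) simp_all
      then have "status_point (?D \<omega> \<inter> T) (?R \<omega> \<inter> T) z \<in>
          convex hull (binary_point ` Pow (?D \<omega> \<inter> T \<union> ?R \<omega> \<inter> T))"
        by (rule status_point_in_hull)
      also have "\<dots> \<subseteq> ?K"
        by (intro hull_mono image_mono Pow_mono) auto
      finally show ?thesis .
    qed
    show ?thesis
    proof (rule ccontr)
      assume "status_point {} T z \<notin> ?K"
      moreover have "convex ?K" "closed ?K"
        by (simp_all add: finite_imp_compact_convex_hull compact_imp_closed)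
      ultimately obtain a b where ab: "a \<bullet> status_point {} T z < b" "\<And>y. y \<in> ?K \<Longrightarrow> b < a \<bullet> y"
        using separating_hyperplane_closed_point by metis
      define J where "J = {S :: 'n neset. elems S \<subseteq> T}"
      let ?G = "random_gain (\<lambda>S. conj_quantity E H z (elems S)) (\<lambda>S. conj_cond H (elems S))
                  (\<lambda>S. z $ S) (($) a) J"
      let ?W = "\<Union>S\<in>J. conj_cond H (elems S)"
      \<comment> \<open>the subfamily and the stakes turn the gain into a difference of inner products with \<open>a\<close>\<close>
      have gain: "?G \<omega> = a \<bullet> status_point (?D \<omega> \<inter> T) (?R \<omega> \<inter> T) z - a \<bullet> status_point {} T z" for \<omega>
      proof -
        have inner: "a \<bullet> status_point (D \<inter> T) (R \<inter> T) z = (\<Sum>S\<in>J. a $ S * status_point D R z $ S)"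
          for D R
        proof -
          have "status_point (D \<inter> T) (R \<inter> T) z $ S =
                (if S \<in> J then status_point D R z $ S else 0)" for S
          proof (cases "S \<in> J")
            case True
            then have "elems S \<inter> (R \<inter> T) = elems S \<inter> R"
                "elems S \<subseteq> D \<inter> T \<union> R \<inter> T \<longleftrightarrow> elems S \<subseteq> D \<union> R"
              by (auto simp: J_def)
            with True show ?thesis
              by (simp add: status_point_def)
          next
            case False
            then have "\<not> elems S \<subseteq> D \<inter> T \<union> R \<inter> T"
              by (auto simp: J_def)
            with False show ?thesis
              by (simp add: status_point_def)
          qed
          then show ?thesis
            unfolding inner_vec_def by (intro sum.mono_neutral_cong_right) simp_all
        qed
        have "(\<Sum>S\<in>J. a $ S * status_point {} UNIV z $ S) = (\<Sum>S\<in>J. a $ S * z $ S)"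
          by (simp add: status_point_def)
        with inner[of "{}" UNIV] have "a \<bullet> status_point {} T z = (\<Sum>S\<in>J. a $ S * z $ S)"
          by simp
        then show ?thesis
          unfolding random_gain_eq inner by (simp add: right_diff_distrib sum_subtractf)
      qed
      from False obtain i where "i \<in> T"
        by blast
      then have i: "neset {i} \<in> J" "elems (neset {i}) = {i}"
        by (simp_all add: J_def elems_neset)
      have "H i \<subseteq> ?W"
        using i by (auto simp: conj_cond_def intro!: bexI[of _ "neset {i}"])
      then have "?W \<noteq> {}"
        using nonempty[of i] by (metis subset_empty)
      then have "Min (?G ` ?W) \<in> ?G ` ?W"
        by (intro Min_in finite_random_gains) simp
      moreover have "Min (?G ` ?W) \<le> 0"
        using coh[unfolded coherent_conjunctions_def coherent_def, rule_format, of J "($) a"] i(1)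
        by auto
      ultimately obtain \<omega> where \<omega>: "\<omega> \<in> ?W" "?G \<omega> \<le> 0"
        by (metis (no_types, lifting) imageE)
      then obtain j where "j \<in> T" "\<omega> \<in> H j"
        by (auto simp: J_def conj_cond_def)
      then have "b < a \<bullet> status_point (?D \<omega> \<inter> T) (?R \<omega> \<inter> T) z"
        by (intro ab(2) values_in_hull)
      with ab(1) \<omega>(2) show False
        unfolding gain by linarith
    qed
  qed
qed

section \<open>Mixtures of binary points are coherent\<close>

lemma logically_independent_world:
  assumes "logically_independent (case_sum E H)"
  obtains \<omega> where "\<And>i. \<omega> \<in> H i" "\<And>i. \<omega> \<in> E i \<longleftrightarrow> i \<in> A"
proof -
  let ?J = "Inl ` A \<union> range Inr"
  obtain \<omega> where "\<omega> \<in> (\<Inter>k\<in>?J. case_sum E H k)" "\<omega> \<in> (\<Inter>k\<in>- ?J. - case_sum E H k)"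
    using assms unfolding logically_independent_def by (meson Int_iff ex_in_conv)
  then have "\<omega> \<in> case_sum E H k \<longleftrightarrow> k \<in> ?J" for k
    by blast
  from this[of "Inr i" for i] this[of "Inl i" for i] have "\<And>i. \<omega> \<in> H i" "\<And>i. \<omega> \<in> E i \<longleftrightarrow> i \<in> A"
    by auto
  then show thesis
    by (rule that)
qed

lemma hull_gain_nonpos:
  fixes z :: "real ^ 'k::finite"
  assumes "z \<in> convex hull B"
  shows "\<exists>q\<in>B. (\<Sum>k\<in>J. s k * (q $ k - z $ k)) \<le> 0"
proof (rule ccontr)
  define a :: "real ^ 'k" where "a = (\<chi> k. if k \<in> J then s k else 0)"
  have a: "(\<Sum>k\<in>J. s k * (q $ k - z $ k)) = a \<bullet> q - a \<bullet> z" for q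
  proof -
    have "a \<bullet> y = (\<Sum>k\<in>J. s k * y $ k)" for y
      by (simp add: a_def inner_vec_def if_distrib[of "\<lambda>t. t * _"] sum.If_cases cong: if_cong)
    then show ?thesis
      by (simp add: right_diff_distrib sum_subtractf)
  qed
  assume "\<not> ?thesis"
  then have "B \<subseteq> {q. a \<bullet> q > a \<bullet> z}"
    unfolding a by force
  then have "convex hull B \<subseteq> {q. a \<bullet> q > a \<bullet> z}"
    by (rule hull_minimal) (rule convex_halfspace_gt)
  with assms show False
    by auto
qed

lemma hull_imp_coherent:
  fixes E H :: "'n::finite \<Rightarrow> 'w set"
  assumes indep: "logically_independent (case_sum E H)"
    and z: "z \<in> convex hull (range binary_point)"
  shows "coherent_conjunctions E H z"
  unfolding coherent_conjunctions_def coherent_def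
proof (intro allI impI)
  fix J :: "'n neset set" and s :: "'n neset \<Rightarrow> real"
  assume J: "finite J \<and> J \<noteq> {}"
  let ?W = "\<Union>S\<in>J. conj_cond H (elems S)"
  let ?G = "random_gain (\<lambda>S. conj_quantity E H z (elems S)) (\<lambda>S. conj_cond H (elems S))
              (\<lambda>S. z $ S) s J"
  have attained: "(\<Sum>S\<in>J. s S * (binary_point A $ S - z $ S)) \<in> ?G ` ?W" for A
  proof -
    obtain \<omega> where \<omega>: "\<And>i. \<omega> \<in> H i" "\<And>i. \<omega> \<in> E i \<longleftrightarrow> i \<in> A"
      using logically_independent_world[OF indep] by metis
    then have "true_indices E H \<omega> = A" "void_indices H \<omega> = {}"
      by (auto simp: true_indices_def void_indices_def)
    then have gain: "?G \<omega> = (\<Sum>S\<in>J. s S * (binary_point A $ S - z $ S))"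
      by (simp add: random_gain_eq status_point_no_void)
    have "\<omega> \<in> ?W"
      using J \<omega>(1) elems_nonempty by (fastforce simp: conj_cond_def)
    then show ?thesis
      unfolding gain[symmetric] by (rule imageI)
  qed
  have fin: "finite (?G ` ?W)"
    by (rule finite_random_gains)
  obtain A where "(\<Sum>S\<in>J. s S * (binary_point A $ S - z $ S)) \<le> 0"
    using hull_gain_nonpos[OF z, of s J] by blast
  with Min_le[OF fin attained] have "Min (?G ` ?W) \<le> 0"
    by (rule order_trans)
  moreover
  \<comment> \<open>opposite stakes exchange gains and losses\<close>
  obtain B where "0 \<le> (\<Sum>S\<in>J. s S * (binary_point B $ S - z $ S))"
    using hull_gain_nonpos[OF z, of "\<lambda>S. - s S" J] by (auto simp: sum_negf)
  then have "0 \<le> Max (?G ` ?W)"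
    using Max_ge[OF fin attained] by (rule order_trans)
  ultimately show "Min (?G ` ?W) \<le> 0 \<and> 0 \<le> Max (?G ` ?W)" ..
qed

section \<open>Constituent points\<close>

theorem theorem17:
  fixes E H :: "'n::finite \<Rightarrow> 'w set"
    and x :: "real ^ 'n neset"
  assumes "logically_independent (case_sum E H)"
    and "coherent_conjunctions E H x"
  shows "\<forall>C \<in> constituents E H.
           coherent_conjunctions E H (constituent_point E H x C) \<and>
           constituent_point E H x C \<in> convex hull (binary_points E H x)"
proof
  fix C assume C: "C \<in> constituents E H"
  then obtain \<omega> where "\<omega> \<in> C"
    unfolding constituents_def by blast
  let ?D = "true_indices E H \<omega>" and ?R = "void_indices H \<omega>"
  have "H i \<noteq> {}" for i
    using logically_independent_world[OF assms(1)] by (metis empty_iff)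
  then have "status_point {} ?R x \<in> convex hull (binary_point ` Pow ?R)"
    using assms(2) by (rule coherent_imp_restriction_in_hull)
  then have "status_point ?D ?R x \<in> convex hull (binary_point ` Pow (?D \<union> ?R))"
    by (rule status_point_in_hull)
  also have "\<dots> \<subseteq> convex hull (range binary_point)"
    by (intro hull_mono image_mono) simp
  finally have "constituent_point E H x C \<in> convex hull (range binary_point)"
    by (simp only: constituent_point_eq_status_point[OF C \<open>\<omega> \<in> C\<close>])
  moreover have "binary_points E H x = range binary_point"
    unfolding binary_points_eq[OF assms(1)] binary_point_def ..
  ultimately show "coherent_conjunctions E H (constituent_point E H x C) \<and>
      constituent_point E H x C \<in> convex hull (binary_points E H x)"
    using hull_imp_coherent[OF assms(1)] by simp
qed

end
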